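(* Let $d,n\geq1$ be integers, let $q=(q_1,\dots,q_d)\in\mathbb{Z}^d$ with $q\neq0$, and let $\delta>0$. Let $\mu$ be a Borel probability measure on $[0,1]^{nd}$. Then there are absolute constants $C_1,C_2>0$ (independent of $d,n$-data other than as stated, of $q$, $\delta$, $\mu$) such that \[ \mu(L_{\delta,q}^n)\le C_1\,\delta^n\Big(1+C_2\sum_{t\in\mathbb{Z}^n,\ 0<|t|_\infty\le 2/\delta}|\hat\mu(t_1q,\dots,t_nq)|\Big), \] and, for all $K>0$ and $N\in\mathbb{N}$, \[ \mu(L_{\delta,q}^n)\ge c_1\,\delta^n\Big(1-c_2\sum_{t\in\mathbb{Z}^n,\ 0<|t|_\infty\le K/\delta}|\hat\mu(t_1q,\dots,t_nq)|\Big)-C_N K^{-N}, \] where $c_1,c_2>0$ are absolute constants and $C_N>0$ depends only on $N$. (In the paper's notation: $\mu(L^n_{\delta,q})\ll\delta^n(1+O(\sum\cdots))$ and $\mu(L^n_{\delta,q})\gg\delta^n(1+O(\sum\cdots))+O_{K\to\infty}(K^{-N})$, with the $O_{K\to\infty}$ constant depending only on $N$ and all other implied constants absolute.)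
   Context: For $q\in\mathbb{Z}^d\setminus\{0\}$ and $\delta>0$, \[ L_{\delta,q}=\{x\in\mathbb{R}^d:\exists r\in\mathbb{Z},\ |q_1x_1+\dots+q_dx_d-r|<\delta\}, \] and $L_{\delta,q}^n=L_{\delta,q}\times\cdots\times L_{\delta,q}\subset\mathbb{R}^{nd}$ ($n$ factors). The Fourier transform of $\mu$ is $\hat\mu(\xi)=\int e^{-2\pi i x\cdot\xi}\,d\mu(x)$ for $\xi\in\mathbb{R}^{nd}$, and for $t=(t_1,\dots,t_n)\in\mathbb{Z}^n$, $(t_1q,\dots,t_nq)=(t_1q_1,\dots,t_1q_d,\dots,t_nq_1,\dots,t_nq_d)\in\mathbb{R}^{nd}$. $|\cdot|_\infty$ is the maximum norm.
   Formalization: The upper bound is proved with C_1^n in place of C_1 (Lebesgue measure with d=1, q=1 gives (2δ)^n, so no C_1 independent of n works), and the lower bound is proved only for 0<δ≤1 (for δ>1 the measure is 1 while c_1 δ^n is unbounded in n). *)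

theory Defs
  imports "HOL-Probability.Probability"
begin

text \<open>
  Since the constants of the theorem must not depend on the dimensions \<open>d\<close> and \<open>n\<close>, these are
  natural numbers and not types: a point of \<open>\<real>\<^sup>d\<close> is an extensional function on \<open>{..<d}\<close>, and
  a point \<open>x\<close> of \<open>\<real>\<^sup>n\<^sup>d = (\<real>\<^sup>d)\<^sup>n\<close> consists of the \<open>n\<close> blocks \<open>x i \<in> \<real>\<^sup>d\<close> with \<open>i < n\<close>.
  As the products are finite and \<open>\<real>\<close> is second countable, the product \<open>\<sigma>\<close>-algebra below is the
  Borel \<open>\<sigma>\<close>-algebra of \<open>\<real>\<^sup>n\<^sup>d\<close>.
\<close>

definition borel_blocks :: "nat \<Rightarrow> nat \<Rightarrow> (nat \<Rightarrow> nat \<Rightarrow> real) measure" where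
  "borel_blocks n d = (\<Pi>\<^sub>M i\<in>{..<n}. \<Pi>\<^sub>M j\<in>{..<d}. borel)"

definition unit_cube :: "nat \<Rightarrow> nat \<Rightarrow> (nat \<Rightarrow> nat \<Rightarrow> real) set" where
  "unit_cube n d = (\<Pi>\<^sub>E i\<in>{..<n}. \<Pi>\<^sub>E j\<in>{..<d}. {0..1})"

text \<open>A measure on the cube is viewed as a measure on \<open>\<real>\<^sup>n\<^sup>d\<close> that gives the cube full mass.\<close>

definition prob_on_cube :: "nat \<Rightarrow> nat \<Rightarrow> (nat \<Rightarrow> nat \<Rightarrow> real) measure \<Rightarrow> bool" where
  "prob_on_cube n d \<mu> \<longleftrightarrow>
     prob_space \<mu> \<and> sets \<mu> = sets (borel_blocks n d) \<and> measure \<mu> (unit_cube n d) = 1"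

definition L :: "nat \<Rightarrow> real \<Rightarrow> (nat \<Rightarrow> int) \<Rightarrow> (nat \<Rightarrow> real) set" where
  "L d \<delta> q = {x \<in> {..<d} \<rightarrow>\<^sub>E UNIV. \<exists>r::int. \<bar>(\<Sum>j<d. of_int (q j) * x j) - of_int r\<bar> < \<delta>}"

definition L_power :: "nat \<Rightarrow> nat \<Rightarrow> real \<Rightarrow> (nat \<Rightarrow> int) \<Rightarrow> (nat \<Rightarrow> nat \<Rightarrow> real) set" where
  "L_power n d \<delta> q = (\<Pi>\<^sub>E i\<in>{..<n}. L d \<delta> q)"

definition fourier_transform ::
  "nat \<Rightarrow> nat \<Rightarrow> (nat \<Rightarrow> nat \<Rightarrow> real) measure \<Rightarrow> (nat \<Rightarrow> nat \<Rightarrow> real) \<Rightarrow> complex" where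
  "fourier_transform n d \<mu> \<xi> =
     (\<integral>x. exp (- 2 * of_real pi * \<i> * of_real (\<Sum>i<n. \<Sum>j<d. x i j * \<xi> i j)) \<partial>\<mu>)"

definition max_norm :: "nat \<Rightarrow> (nat \<Rightarrow> int) \<Rightarrow> int" where
  "max_norm n t = Max ((\<lambda>i. \<bar>t i\<bar>) ` {..<n})"

definition frequencies :: "nat \<Rightarrow> real \<Rightarrow> (nat \<Rightarrow> int) set" where
  "frequencies n R =
     {t \<in> {..<n} \<rightarrow>\<^sub>E UNIV. 0 < max_norm n t \<and> of_int (max_norm n t) \<le> R}"

definition fourier_sum ::
  "nat \<Rightarrow> nat \<Rightarrow> (nat \<Rightarrow> int) \<Rightarrow> (nat \<Rightarrow> nat \<Rightarrow> real) measure \<Rightarrow> real \<Rightarrow> real" where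
  "fourier_sum n d q \<mu> R =
     (\<Sum>t\<in>frequencies n R. cmod (fourier_transform n d \<mu> (\<lambda>i j. of_int (t i * q j))))"

text \<open>
  The next two facts rule out the default values of \<^const>\<open>sum\<close> on infinite sets and of
  \<^const>\<open>measure\<close> on non-measurable sets.
\<close>

lemma finite_frequencies: "finite (frequencies n R)"
proof (cases "n = 0")
  case True
  then have "frequencies n R \<subseteq> {..<n} \<rightarrow>\<^sub>E {0}"
    by (auto simp: frequencies_def)
  then show ?thesis
    by (rule finite_subset) (auto intro!: finite_PiE)
next
  case False
  have "frequencies n R \<subseteq> {..<n} \<rightarrow>\<^sub>E {- \<lfloor>R\<rfloor>..\<lfloor>R\<rfloor>}"
  proof
    fix t assume t: "t \<in> frequencies n R"
    have "t i \<in> {- \<lfloor>R\<rfloor>..\<lfloor>R\<rfloor>}" if "i < n" for i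
    proof -
      have "\<bar>t i\<bar> \<le> max_norm n t"
        unfolding max_norm_def using that by (intro Max_ge) auto
      also have "\<dots> \<le> \<lfloor>R\<rfloor>"
        using t by (simp add: frequencies_def le_floor_iff)
      finally show ?thesis by auto
    qed
    then show "t \<in> {..<n} \<rightarrow>\<^sub>E {- \<lfloor>R\<rfloor>..\<lfloor>R\<rfloor>}"
      using t by (auto simp: frequencies_def PiE_iff)
  qed
  then show ?thesis
    by (rule finite_subset) (auto intro!: finite_PiE)
qed

lemma L_power_measurable: "L_power n d \<delta> q \<in> sets (borel_blocks n d)"
proof -
  have "{x \<in> space (\<Pi>\<^sub>M j\<in>{..<d}. borel :: real measure).
          \<exists>r::int. \<bar>(\<Sum>j<d. of_int (q j) * x j) - of_int r\<bar> < \<delta>}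
        \<in> sets (\<Pi>\<^sub>M j\<in>{..<d}. borel)"
    by measurable
  then have "L d \<delta> q \<in> sets (\<Pi>\<^sub>M j\<in>{..<d}. borel)"
    by (simp add: L_def space_PiM)
  then show ?thesis
    unfolding L_power_def borel_blocks_def by (intro sets_PiM_I_finite) auto
qed

lemma unit_cube_measurable: "unit_cube n d \<in> sets (borel_blocks n d)"
  unfolding unit_cube_def borel_blocks_def by (intro sets_PiM_I_finite) auto

end

theory Submission
  imports Defs
begin

text \<open>
  Let \<open>y\<^sub>i = q \<bullet> x\<^sub>i\<close>, so that \<open>L\<^sup>n\<close> is the set where every \<open>y\<^sub>i\<close> is within \<open>\<delta>\<close> of an integer. If
  \<open>f \<ge> 0\<close> is a trigonometric polynomial of degree at most \<open>R\<close> with mean \<open>a\<close>, then all its coefficients are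
  bounded by \<open>a\<close>; expanding the product shows that \<open>\<integral> \<Prod>\<^sub>i f(y\<^sub>i) d\<mu>\<close> differs from \<open>a\<^sup>n\<close> by at most
  \<open>a\<^sup>n\<close> times the sum of \<open>|\<mu>^(t q)|\<close> over \<open>0 < |t| \<le> R\<close>.

  For the upper bound take a rescaled Fejer kernel of degree at most \<open>1/(6\<delta>)\<close>, which is at least \<open>1\<close>
  near the integers. For the lower bound take the convolution of the indicator of
  \<open>[-3\<delta>/4, 3\<delta>/4]\<close> with the normalised \<open>N\<close>-th power of a Fejer kernel, of total degree at most
  \<open>K/\<delta>\<close>. It takes values in \<open>[0,1]\<close>, has mean \<open>3\<delta>/2 \<ge> \<delta>\<close> and is \<open>O(K\<^sup>-\<^sup>N)\<close> at distance at least
  \<open>\<delta>\<close> from the integers; since each factor is at most \<open>1\<close>, no constant depending on \<open>n\<close> arises.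
\<close>

section \<open>Trigonometric polynomials\<close>

text \<open>The minus sign matches \<open>fourier_transform\<close>, so that products of characters
  integrate to its values without conjugation.\<close>

definition character :: "int \<Rightarrow> real \<Rightarrow> complex" where
  "character k y = cis (- (2 * pi * (of_int k * y)))"

lemma character_zero [simp]: "character 0 y = 1"
  by (simp add: character_def)

lemma norm_character [simp]: "cmod (character k y) = 1"
  by (simp add: character_def)

lemma cnj_character [simp]: "cnj (character k y) = character (- k) y"
  by (simp add: character_def cis_cnj)

lemma character_add: "character (j + k) y = character j y * character k y"
  by (simp add: character_def cis_mult algebra_simps)

lemma character_diff_arg: "character k (y - z) = character k y * character (- k) z"
  by (simp add: character_def cis_mult algebra_simps)

lemma character_of_nat: "character (int k) y = character 1 y ^ k"
  by (simp add: character_def Complex.DeMoivre algebra_simps)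

lemma character_shift: "character k (y - of_int r) = character k y"
proof -
  have "- (2 * pi * (of_int k * (y - of_int r)))
      = - (2 * pi * (of_int k * y)) + 2 * pi * of_int (k * r)"
    by (simp add: algebra_simps)
  then show ?thesis
    unfolding character_def by (simp only: cis_mult [symmetric] cis_multiple_2pi Ints_of_int mult_1_right)
qed

lemma continuous_on_character [continuous_intros]: "continuous_on S (character k)"
  unfolding character_def cis_conv_exp by (intro continuous_intros)

text \<open>Orthogonality: for k nonzero the antiderivative exp(w y)/w has period 1. The left
  endpoint is kept free because later integrals run over periods centred at 0 or at y.\<close>

lemma has_integral_character:
  "(character k has_integral (if k = 0 then 1 else 0)) {a..a + 1}"
proof (cases "k = 0")
  case True
  then have "character k = (\<lambda>_. 1)"
    by auto
  then show ?thesis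
    using True has_integral_const_real [of "1::complex" a "a + 1"] by simp
next
  case False
  define w :: complex where "w = - (2 * of_real pi * of_int k * \<i>)"
  have w: "w \<noteq> 0"
    using False by (simp add: w_def)
  have char: "character k y = exp (w * of_real y)" for y
    by (simp add: character_def cis_conv_exp w_def algebra_simps)
  have "((\<lambda>y. exp (w * of_real y) / w) has_vector_derivative character k y) (at y within {a..a + 1})" for y
  proof -
    have "((\<lambda>z. exp (w * z) / w) has_field_derivative exp (w * of_real y)) (at (of_real y))"
      using w by (auto intro!: derivative_eq_intros)
    then show ?thesis
      unfolding char by (rule has_vector_derivative_real_field)
  qed
  then have "(character k has_integral exp (w * of_real (a + 1)) / w - exp (w * of_real a) / w) {a..a + 1}"
    by (intro fundamental_theorem_of_calculus) auto
  moreover have "exp (w * of_real (a + 1)) = exp (w * of_real a)"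
    using character_shift [of k "a + 1" 1] by (simp add: char)
  ultimately show ?thesis
    using False by simp
qed

section \<open>Trigonometric polynomials of bounded degree and their coefficients\<close>

definition trig_poly :: "nat \<Rightarrow> (real \<Rightarrow> complex) \<Rightarrow> bool" where
  "trig_poly D f \<longleftrightarrow> (\<exists>c. \<forall>y. f y = (\<Sum>k\<in>{- int D..int D}. c k * character k y))"

lemma trig_poly_character: "\<bar>k\<bar> \<le> int D \<Longrightarrow> trig_poly D (character k)"
  unfolding trig_poly_def
  by (intro exI [of _ "\<lambda>j. if j = k then 1 else 0"]) (auto simp: if_distrib [of "\<lambda>x. x * _"] cong: if_cong)

lemma trig_poly_cmult: "trig_poly D f \<Longrightarrow> trig_poly D (\<lambda>y. a * f y)"
proof -
  assume "trig_poly D f"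
  then obtain c where "\<And>y. f y = (\<Sum>k\<in>{- int D..int D}. c k * character k y)"
    unfolding trig_poly_def by blast
  then show ?thesis
    unfolding trig_poly_def by (intro exI [of _ "\<lambda>k. a * c k"]) (simp add: sum_distrib_left mult.assoc)
qed

lemma trig_poly_add: "trig_poly D f \<Longrightarrow> trig_poly D g \<Longrightarrow> trig_poly D (\<lambda>y. f y + g y)"
proof -
  assume "trig_poly D f" "trig_poly D g"
  then obtain b c where "\<And>y. f y = (\<Sum>k\<in>{- int D..int D}. b k * character k y)"
    "\<And>y. g y = (\<Sum>k\<in>{- int D..int D}. c k * character k y)"
    unfolding trig_poly_def by blast
  then show ?thesis
    unfolding trig_poly_def
    by (intro exI [of _ "\<lambda>k. b k + c k"]) (simp add: sum.distrib distrib_right)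
qed

lemma trig_poly_0: "trig_poly D (\<lambda>y. 0)"
  unfolding trig_poly_def by (intro exI [of _ "\<lambda>k. 0"]) simp

lemma trig_poly_sum:
  "(\<And>i. i \<in> I \<Longrightarrow> trig_poly D (f i)) \<Longrightarrow> trig_poly D (\<lambda>y. \<Sum>i\<in>I. f i y)"
  by (induction I rule: infinite_finite_induct) (auto intro: trig_poly_add trig_poly_0)

lemma trig_poly_mult:
  assumes "trig_poly D f" "trig_poly E g"
  shows "trig_poly (D + E) (\<lambda>y. f y * g y)"
proof -
  obtain b c where f: "\<And>y. f y = (\<Sum>k\<in>{- int D..int D}. b k * character k y)"
    and g: "\<And>y. g y = (\<Sum>k\<in>{- int E..int E}. c k * character k y)"
    using assms unfolding trig_poly_def by blast
  have "(\<lambda>y. f y * g y)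
      = (\<lambda>y. \<Sum>j\<in>{- int D..int D}. \<Sum>k\<in>{- int E..int E}. (b j * c k) * character (j + k) y)"
    unfolding f g sum_product by (simp add: character_add mult_ac)
  moreover have "trig_poly (D + E) \<dots>"
    by (intro trig_poly_sum trig_poly_cmult trig_poly_character) auto
  ultimately show ?thesis
    by simp
qed

lemma trig_poly_power: "trig_poly D f \<Longrightarrow> trig_poly (m * D) (\<lambda>y. f y ^ m)"
proof (induction m)
  case 0
  have "character 0 = (\<lambda>_. 1)"
    by auto
  then show ?case
    using trig_poly_character [of 0 0] by simp
next
  case (Suc m)
  then show ?case
    using trig_poly_mult [of D f "m * D" "\<lambda>y. f y ^ m"] by simp
qed

lemma trig_poly_continuous_on: "trig_poly D f \<Longrightarrow> continuous_on S f"
  unfolding trig_poly_def by (auto intro!: continuous_intros simp: fun_eq_iff [symmetric])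

lemma trig_poly_continuous_on_real:
  "trig_poly D (\<lambda>y. of_real (f y)) \<Longrightarrow> continuous_on S f"
  using continuous_on_Re [OF trig_poly_continuous_on, of D "\<lambda>y. of_real (f y)" S] by simp

text \<open>Multiplying by \<open>character (- j)\<close> shifts all frequencies by j, and
  orthogonality leaves only the j-th coefficient.\<close>

lemma trig_poly_coeff_has_integral:
  assumes "\<And>y. f y = (\<Sum>k\<in>{- int D..int D}. c k * character k y)" and j: "j \<in> {- int D..int D}"
  shows "((\<lambda>y. f y * character (- j) y) has_integral c j) {a..a + 1}"
proof -
  have "((\<lambda>y. \<Sum>k\<in>{- int D..int D}. c k * character (k - j) y)
      has_integral (\<Sum>k\<in>{- int D..int D}. c k * (if k - j = 0 then 1 else 0))) {a..a + 1}"
    by (intro has_integral_sum has_integral_mult_right has_integral_character) auto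
  moreover have "(\<Sum>k\<in>{- int D..int D}. c k * (if k - j = 0 then 1 else 0)) = c j"
    using j by (simp add: if_distrib [of "\<lambda>x. _ * x"] cong: if_cong)
  moreover have "(\<Sum>k\<in>{- int D..int D}. c k * character (k - j) y) = f y * character (- j) y" for y
    using character_add [of _ "- j" y] by (simp add: assms(1) sum_distrib_right mult.assoc)
  ultimately show ?thesis
    by simp
qed

text \<open>The integral over every period is the real part of the constant coefficient, so it does
  not depend on \<open>a\<close>.\<close>

lemma trig_poly_has_integral_unit:
  assumes f: "trig_poly D (\<lambda>y. of_real (f y))"
  shows "(f has_integral integral {0..1} f) {a..a + 1}"
proof -
  obtain c where c: "\<And>y. complex_of_real (f y) = (\<Sum>k\<in>{- int D..int D}. c k * character k y)"
    using f unfolding trig_poly_def by blast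
  have *: "(f has_integral Re (c 0)) {b..b + 1}" for b
    using has_integral_linear [OF trig_poly_coeff_has_integral [OF c, of 0 b] bounded_linear_Re]
    by (simp add: o_def)
  then show ?thesis
    using integral_unique [OF * [of 0]] by simp
qed

text \<open>A Fourier coefficient is bounded by the L^1 norm, which for a nonnegative function is
  its mean. This is what makes the later error terms proportional to the main term.\<close>

lemma nonneg_trig_poly_coeffs:
  assumes f: "trig_poly D (\<lambda>y. of_real (f y))" and nonneg: "\<And>y. f y \<ge> 0"
  obtains c where "\<And>y. complex_of_real (f y) = (\<Sum>k\<in>{- int D..int D}. c k * character k y)"
    and "c 0 = of_real (integral {0..1} f)"
    and "\<And>k. k \<in> {- int D..int D} \<Longrightarrow> cmod (c k) \<le> integral {0..1} f"
proof -
  obtain c where c: "\<And>y. complex_of_real (f y) = (\<Sum>k\<in>{- int D..int D}. c k * character k y)"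
    using f unfolding trig_poly_def by blast
  have int: "f integrable_on {0..1}"
    using trig_poly_has_integral_unit [OF f, of 0] by (auto simp: has_integral_integrable)
  have "((\<lambda>y. complex_of_real (f y)) has_integral of_real (integral {0..1} f)) {0..1}"
    using has_integral_linear [OF integrable_integral [OF int] bounded_linear_of_real]
    by (simp add: o_def)
  moreover have "((\<lambda>y. complex_of_real (f y)) has_integral c 0) {0..1}"
    using trig_poly_coeff_has_integral [OF c, of 0 0] by simp
  ultimately have "c 0 = of_real (integral {0..1} f)"
    by (rule has_integral_unique [symmetric])
  moreover have "cmod (c k) \<le> integral {0..1} f" if "k \<in> {- int D..int D}" for k
  proof -
    note hi = trig_poly_coeff_has_integral [OF c that, of 0]
    have "cmod (integral {0..0 + 1} (\<lambda>y. complex_of_real (f y) * character (- k) y)) \<le> integral {0..0 + 1} f"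
      by (rule integral_norm_bound_integral)
        (use int hi nonneg in \<open>auto simp: has_integral_integrable norm_mult\<close>)
    then show ?thesis
      using integral_unique [OF hi] by simp
  qed
  ultimately show thesis
    using that c by blast
qed

text \<open>Convolution with the indicator of [-h, h] multiplies the k-th coefficient by the
  integral of \<open>character (- k)\<close> over [-h, h]. The degree bound is therefore kept, and
  the mean is multiplied by the window length 2h.\<close>

lemma trig_poly_average:
  fixes f :: "real \<Rightarrow> real"
  assumes f: "trig_poly D (\<lambda>y. of_real (f y))" and h: "h \<ge> 0"
  defines "g \<equiv> \<lambda>y. integral {- h..h} (\<lambda>z. f (y - z))"
  shows "trig_poly D (\<lambda>y. of_real (g y))"
    and "integral {0..1} g = 2 * h * integral {0..1} f"
proof -
  obtain c where c: "\<And>y. complex_of_real (f y) = (\<Sum>k\<in>{- int D..int D}. c k * character k y)"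
    using f unfolding trig_poly_def by blast
  define s where "s k = integral {- h..h} (character (- k))" for k
  have s: "(character (- k) has_integral s k) {- h..h}" for k
    unfolding s_def by (intro integrable_integral integrable_continuous_real continuous_intros)
  have cont: "continuous_on UNIV f"
    using f by (rule trig_poly_continuous_on_real)
  have g: "complex_of_real (g y) = (\<Sum>k\<in>{- int D..int D}. (c k * s k) * character k y)" for y
  proof -
    have "(\<lambda>z. f (y - z)) integrable_on {- h..h}"
      by (intro integrable_continuous_real continuous_on_compose2 [OF cont] continuous_intros) auto
    then have "((\<lambda>z. complex_of_real (f (y - z))) has_integral of_real (g y)) {- h..h}"
      using has_integral_linear [OF integrable_integral bounded_linear_of_real]
      unfolding g_def o_def by blast
    moreover have "((\<lambda>z. \<Sum>k\<in>{- int D..int D}. (c k * character k y) * character (- k) z) has_integral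
        (\<Sum>k\<in>{- int D..int D}. (c k * character k y) * s k)) {- h..h}"
      by (intro has_integral_sum has_integral_mult_right s) auto
    ultimately show ?thesis
      unfolding c character_diff_arg by (auto simp: mult_ac dest: has_integral_unique)
  qed
  then show tp: "trig_poly D (\<lambda>y. of_real (g y))"
    unfolding trig_poly_def by (intro exI [of _ "\<lambda>k. c k * s k"]) simp
  have "((\<lambda>y. complex_of_real (g y)) has_integral c 0 * s 0) {0..1}"
    using trig_poly_coeff_has_integral [OF g, of 0 0] by simp
  moreover have "s 0 = of_real (2 * h)"
  proof -
    have "character 0 = (\<lambda>_. 1)"
      by auto
    then show ?thesis
      using h unfolding s_def by (simp add: scaleR_conv_of_real)
  qed
  moreover have "((\<lambda>y. complex_of_real (g y)) has_integral of_real (integral {0..1} g)) {0..1}"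
    using has_integral_linear [OF trig_poly_has_integral_unit [OF tp, of 0] bounded_linear_of_real]
    by (simp add: o_def)
  moreover have "((\<lambda>y. complex_of_real (f y)) has_integral of_real (integral {0..1} f)) {0..1}"
    using has_integral_linear [OF trig_poly_has_integral_unit [OF f, of 0] bounded_linear_of_real]
    by (simp add: o_def)
  moreover have "((\<lambda>y. complex_of_real (f y)) has_integral c 0) {0..1}"
    using trig_poly_coeff_has_integral [OF c, of 0 0] by simp
  ultimately have "complex_of_real (integral {0..1} g) = of_real (2 * h * integral {0..1} f)"
    by (metis has_integral_unique mult.commute of_real_mult)
  then show "integral {0..1} g = 2 * h * integral {0..1} f"
    by (simp only: of_real_eq_iff)
qed

section \<open>The Fejer kernel\<close>

text \<open>This is M times the Fejer kernel of mean 1, that is (sin(pi M y) / sin(pi y))^2 off the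
  integers. As a squared modulus it is visibly nonnegative.\<close>

definition fejer :: "nat \<Rightarrow> real \<Rightarrow> real" where
  "fejer M y = (cmod (\<Sum>k<M. character (int k) y))\<^sup>2"

lemma fejer_nonneg [simp]: "fejer M y \<ge> 0"
  by (simp add: fejer_def)

lemma fejer_eq_sum:
  "complex_of_real (fejer M y) = (\<Sum>j<M. \<Sum>k<M. character (int j - int k) y)"
proof -
  have "complex_of_real (fejer M y)
      = (\<Sum>k<M. character (int k) y) * cnj (\<Sum>k<M. character (int k) y)"
    unfolding fejer_def by (rule complex_norm_square)
  then show ?thesis
    using character_add [of "int _" "- int _" y] by (simp add: sum_product)
qed

lemma trig_poly_fejer: "trig_poly (M - 1) (\<lambda>y. of_real (fejer M y))"
  unfolding fejer_eq_sum by (intro trig_poly_sum trig_poly_character) auto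

text \<open>Only the M diagonal terms of the double sum have frequency 0.\<close>

lemma integral_fejer: "integral {0..1} (fejer M) = real M"
proof -
  have "((\<lambda>y. complex_of_real (fejer M y)) has_integral
      (\<Sum>j<M. \<Sum>k<M. if int j - int k = 0 then 1 else 0)) {0..0 + 1}"
    unfolding fejer_eq_sum by (intro has_integral_sum has_integral_character) auto
  moreover have "(\<Sum>j<M. \<Sum>k<M. if int j - int k = 0 then 1 else 0) = (of_nat M :: complex)"
    by simp
  ultimately have "((\<lambda>y. complex_of_real (fejer M y)) has_integral of_nat M) {0..1}"
    by simp
  from has_integral_linear [OF this bounded_linear_Re] show ?thesis
    by (simp add: o_def integral_unique)
qed

section \<open>Size of the Fejer kernel near the integers and away from them\<close>

text \<open>All phases 2 pi k (y - r) with k < M lie within pi/3 of 0, so each summand has real part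
  at least cos(pi/3) = 1/2 and nothing cancels.\<close>

lemma fejer_lower:
  assumes "real (M - 1) * \<bar>y - of_int r\<bar> \<le> 1 / 6"
  shows "(real M / 2)\<^sup>2 \<le> fejer M y"
proof -
  have "1 / 2 \<le> Re (character (int k) y)" if "k < M" for k
  proof -
    have "real k * \<bar>y - of_int r\<bar> \<le> real (M - 1) * \<bar>y - of_int r\<bar>"
      using that by (intro mult_right_mono) auto
    also have "\<dots> \<le> 1 / 6"
      by (fact assms)
    finally have "2 * pi * (real k * \<bar>y - of_int r\<bar>) \<le> 2 * pi * (1 / 6)"
      by (intro mult_left_mono) auto
    then have "cos (pi / 3) \<le> cos (2 * pi * (real k * \<bar>y - of_int r\<bar>))"
      by (intro cos_monotone_0_pi_le) auto
    also have "\<dots> = Re (character (int k) (y - of_int r))"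
      using cos_abs_real [of "2 * pi * (real k * (y - of_int r))"]
      by (simp add: character_def abs_mult)
    finally show ?thesis
      by (simp add: character_shift cos_60)
  qed
  then have "(\<Sum>k<M. 1 / 2) \<le> (\<Sum>k<M. Re (character (int k) y))"
    by (intro sum_mono) auto
  also have "\<dots> \<le> cmod (\<Sum>k<M. character (int k) y)"
    using complex_Re_le_cmod [of "\<Sum>k<M. character (int k) y"] by simp
  finally show ?thesis
    unfolding fejer_def by (intro power_mono) auto
qed

text \<open>With u the signed distance from y to its nearest integer, the chord has length 2 |sin(pi
  u)|. It suffices that sin x \<ge> x/2 for x = pi |u|, since then 2 sin x \<ge> x \<ge> 2
  |u|.\<close>

lemma norm_character_minus_1_ge:
  assumes "\<And>r::int. \<bar>y - of_int r\<bar> \<ge> \<eta>" and "\<eta> \<ge> 0"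
  shows "2 * \<eta> \<le> cmod (character 1 y - 1)"
proof -
  define u where "u = y - of_int (round y)"
  have u: "\<bar>u\<bar> \<le> 1 / 2"
    using of_int_round_abs_le [of y] by (simp add: u_def abs_minus_commute)
  define x where "x = pi * \<bar>u\<bar>"
  have x: "0 \<le> x" "x \<le> 1.6"
  proof -
    have "pi * \<bar>u\<bar> \<le> 3.2 * (1 / 2)"
      using u pi_approx by (intro mult_mono) auto
    then show "x \<le> 1.6" "0 \<le> x"
      by (auto simp: x_def)
  qed
  \<comment> \<open>The Taylor remainder is at most x/2 as soon as x^2 \<le> 3, which the crude
    bound x \<le> 1.6 ensures.\<close>
  have "\<bar>sin x - x\<bar> \<le> x ^ 3 / 6"
    using Maclaurin_sin_bound [of x 3] x
    by (simp add: sin_coeff_def numeral_3_eq_3 fact_numeral)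
  moreover have "x * x\<^sup>2 \<le> x * 3"
  proof (intro mult_left_mono)
    have "x\<^sup>2 \<le> 1.6\<^sup>2"
      using x by (intro power_mono) auto
    then show "x\<^sup>2 \<le> 3"
      by (simp add: power2_eq_square)
  qed (use x in auto)
  moreover have "x ^ 3 = x * x\<^sup>2"
    by (simp add: power3_eq_cube power2_eq_square)
  ultimately have "x / 2 \<le> sin x"
    by linarith
  moreover have "2 * \<bar>u\<bar> \<le> x"
    unfolding x_def using pi_ge_two by (intro mult_right_mono) auto
  moreover have "\<eta> \<le> \<bar>u\<bar>"
    using assms(1) by (simp add: u_def)
  moreover have "cmod (character 1 y - 1) = 2 * \<bar>sin x\<bar>"
  proof -
    have "character 1 y = exp (\<i> * of_real (- (2 * pi * u)))"
      using character_shift [of 1 y "round y"] by (simp add: u_def character_def cis_conv_exp)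
    then have "cmod (character 1 y - 1) = 2 * \<bar>sin (- (pi * u))\<bar>"
      using dist_exp_i_1 [of "- (2 * pi * u)"] by simp
    then show ?thesis
      by (simp add: x_def abs_if)
  qed
  ultimately show ?thesis
    by linarith
qed

text \<open>Summing the geometric series gives a numerator of modulus at most 2 over a denominator
  of modulus at least 2 \<eta>; the bound is uniform in M.\<close>

lemma fejer_upper:
  assumes "\<And>r::int. \<bar>y - of_int r\<bar> \<ge> \<eta>" and "\<eta> > 0"
  shows "fejer M y \<le> (1 / \<eta>)\<^sup>2"
proof -
  let ?S = "\<Sum>k<M. character (int k) y"
  have "(character 1 y - 1) * ?S = character 1 y ^ M - 1"
    unfolding character_of_nat by (rule power_diff_1_eq [symmetric])
  then have "cmod (character 1 y - 1) * cmod ?S = cmod (character 1 y ^ M - 1)"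
    by (metis norm_mult)
  also have "\<dots> \<le> 2"
    using norm_triangle_ineq4 [of "character 1 y ^ M" 1] by (simp add: norm_power)
  finally have "cmod (character 1 y - 1) * cmod ?S \<le> 2" .
  moreover have "2 * \<eta> * cmod ?S \<le> cmod (character 1 y - 1) * cmod ?S"
    using norm_character_minus_1_ge [of \<eta> y] assms by (intro mult_right_mono) auto
  ultimately have "cmod ?S \<le> 1 / \<eta>"
    using assms(2) by (simp add: field_simps)
  then show ?thesis
    unfolding fejer_def by (intro power_mono) auto
qed

text \<open>Only the peak |y| \<le> 1/(6M), of length 1/(3M), is counted; there
  \<open>fejer_lower\<close> applies. This bounds from below the normalising constant of the kernel
  in the minorant.\<close>

lemma integral_fejer_power_ge:
  assumes M: "M \<ge> 1"
  shows "(real M / 2) ^ (2 * m) / (3 * real M) \<le> integral {0..1} (\<lambda>y. fejer M y ^ m)"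
proof -
  let ?b = "1 / (6 * real M)"
  have tp: "trig_poly (m * (M - 1)) (\<lambda>y. of_real (fejer M y ^ m))"
    using trig_poly_power [OF trig_poly_fejer, of m M] by simp
  \<comment> \<open>The period is centred at 0 so that the peak is a single subinterval.\<close>
  have hi: "((\<lambda>y. fejer M y ^ m) has_integral integral {0..1} (\<lambda>y. fejer M y ^ m)) {- 1 / 2..1 / 2}"
    using trig_poly_has_integral_unit [OF tp, of "- 1 / 2"] by simp
  have b: "?b \<le> 1 / 2" "0 < ?b"
    using M by (auto simp: field_simps)
  have sub: "{- ?b..?b} \<subseteq> {- 1 / 2..1 / 2}"
    using b by auto
  have io: "(\<lambda>y. fejer M y ^ m) integrable_on {- ?b..?b}"
    using integrable_on_subinterval [OF has_integral_integrable [OF hi] sub] .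
  have "((\<lambda>y. (real M / 2) ^ (2 * m)) has_integral (real M / 2) ^ (2 * m) / (3 * real M)) {- ?b..?b}"
    using has_integral_const_real [of "(real M / 2) ^ (2 * m)" "- ?b" ?b] M by (simp add: field_simps)
  then have "(real M / 2) ^ (2 * m) / (3 * real M) \<le> integral {- ?b..?b} (\<lambda>y. fejer M y ^ m)"
  proof (rule has_integral_le [OF _ integrable_integral [OF io]])
    fix y assume y: "y \<in> {- ?b..?b}"
    have "real (M - 1) * \<bar>y - of_int 0\<bar> \<le> real M * ?b"
      using y by (intro mult_mono) auto
    also have "\<dots> = 1 / 6"
      using M by simp
    finally have "(real M / 2)\<^sup>2 \<le> fejer M y"
      by (rule fejer_lower)
    then show "(real M / 2) ^ (2 * m) \<le> fejer M y ^ m"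
      unfolding power_mult by (intro power_mono) auto
  qed
  also have "\<dots> \<le> integral {- 1 / 2..1 / 2} (\<lambda>y. fejer M y ^ m)"
    by (intro integral_subset_le sub io has_integral_integrable [OF hi]) auto
  also have "\<dots> = integral {0..1} (\<lambda>y. fejer M y ^ m)"
    using hi by (rule integral_unique)
  finally show ?thesis .
qed


section \<open>Majorants and minorants of the indicator of \<open>L\<close>\<close>

text \<open>The kernel \<open>fejer M\<close> is divided by its lower bound (M/2)^2 near the
  integers, so the mean becomes 4/M, which is O(\<delta>) for M of order 1/\<delta>.\<close>

lemma trig_poly_majorant:
  assumes \<delta>: "\<delta> > 0"
  obtains f D where "trig_poly D (\<lambda>y. of_real (f y))" "real D \<le> 2 / \<delta>"
    "\<And>y. f y \<ge> 0" "\<And>y r. \<bar>y - of_int r\<bar> < \<delta> \<Longrightarrow> 1 \<le> f y"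
    "integral {0..1} f \<le> 24 * \<delta>"
proof -
  \<comment> \<open>Rounding up serves both sides: M \<ge> 1/(6 \<delta>) bounds the mean by 24
    \<delta>, while M - 1 \<le> 1/(6 \<delta>) controls the degree and meets the hypothesis of
    \<open>fejer_lower\<close>. For large \<delta> this gives M = 1 and a constant majorant.\<close>
  define M where "M = nat \<lceil>1 / (6 * \<delta>)\<rceil>"
  have M_ge: "1 / (6 * \<delta>) \<le> real M"
    using real_nat_ceiling_ge unfolding M_def .
  then have M0: "M > 0"
    using \<delta> by (intro gr0I) (auto simp: divide_le_0_iff)
  have M1: "real (M - 1) \<le> 1 / (6 * \<delta>)"
  proof -
    have "real M < 1 / (6 * \<delta>) + 1"
      unfolding M_def using \<delta> by (simp add: of_nat_nat) linarith
    then show ?thesis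
      using M0 by (simp add: of_nat_diff)
  qed
  define f where "f y = 4 / (real M)\<^sup>2 * fejer M y" for y
  show thesis
  proof
    show "trig_poly (M - 1) (\<lambda>y. of_real (f y))"
      unfolding f_def of_real_mult by (intro trig_poly_cmult trig_poly_fejer)
    have "1 / (6 * \<delta>) \<le> 2 / \<delta>"
      using \<delta> by (simp add: field_simps)
    with M1 show "real (M - 1) \<le> 2 / \<delta>"
      by linarith
    show "f y \<ge> 0" for y
      by (simp add: f_def)
    show "1 \<le> f y" if "\<bar>y - of_int r\<bar> < \<delta>" for y r
    proof -
      have "real (M - 1) * \<bar>y - of_int r\<bar> \<le> 1 / (6 * \<delta>) * \<delta>"
        using M1 that \<delta> by (intro mult_mono) auto
      also have "\<dots> = 1 / 6"
        using \<delta> by simp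
      finally have "(real M / 2)\<^sup>2 \<le> fejer M y"
        by (rule fejer_lower)
      then have "4 / (real M)\<^sup>2 * (real M / 2)\<^sup>2 \<le> f y"
        unfolding f_def by (intro mult_left_mono) auto
      then show ?thesis
        using M0 by (simp add: power_divide)
    qed
    have "integral {0..1} f = 4 / (real M)\<^sup>2 * real M"
      unfolding f_def using integral_fejer [of M] by simp
    also have "\<dots> = 4 / real M"
      using M0 by (simp add: power2_eq_square)
    also have "\<dots> \<le> 24 * \<delta>"
      using M_ge M0 \<delta> by (simp add: field_simps)
    finally show "integral {0..1} f \<le> 24 * \<delta>" .
  qed
qed

text \<open>Averaging a nonnegative kernel J of mean 1 over a window of length at most 1 gives
  values in [0,1]. At distance \<delta> from the integers the window meets only the tail of J, which
  decays fast because J is an N-th power.\<close>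

lemma trig_poly_minorant:
  fixes K \<delta> :: real and N :: nat
  assumes \<delta>: "0 < \<delta>" "\<delta> \<le> 1 / 2" and N: "N \<ge> 1" and K: "K \<ge> 16 * real N"
  obtains f D where "trig_poly D (\<lambda>y. of_real (f y))" "real D \<le> K / \<delta>"
    "\<And>y. f y \<ge> 0" "\<And>y. f y \<le> 1"
    "\<And>y. \<forall>r::int. \<bar>y - of_int r\<bar> \<ge> \<delta> \<Longrightarrow> f y \<le> 36 * (16 * real N / K) ^ N"
    "integral {0..1} f \<ge> \<delta>"
proof -
  \<comment> \<open>The N-th power has degree N(M - 1), which must stay below K/\<delta>. As the
    quotient is at least 2, taking the floor loses at most a factor 2.\<close>
  define M where "M = nat \<lfloor>K / (real N * \<delta>)\<rfloor>"
  have quot: "K / (real N * \<delta>) \<ge> 2"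
  proof -
    have "2 * (real N * \<delta>) \<le> 2 * (real N * 1)"
      using \<delta> by (intro mult_left_mono) auto
    also have "\<dots> \<le> K"
      using K by linarith
    finally show ?thesis
      using \<delta> N by (simp add: field_simps)
  qed
  then have M_le: "real M \<le> K / (real N * \<delta>)" and M_gt: "K / (real N * \<delta>) < real M + 1"
    unfolding M_def by (auto simp: of_nat_nat)
  have M_ge: "K / (2 * real N * \<delta>) \<le> real M"
  proof -
    have "K / (2 * real N * \<delta>) = K / (real N * \<delta>) / 2"
      by simp
    moreover have "x / 2 \<le> real M" if "2 \<le> x" "x < real M + 1" for x
      using that by simp
    ultimately show ?thesis
      using quot M_gt by metis
  qed
  have K0: "K > 0"
    using K N by linarith
  have M1: "M \<ge> 1"
    using quot M_gt by linarith
  define A where "A = integral {0..1} (\<lambda>y. fejer M y ^ N)"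
  have A: "(real M / 2) ^ (2 * N) / (3 * real M) \<le> A"
    unfolding A_def using M1 by (rule integral_fejer_power_ge)
  moreover have "0 < (real M / 2) ^ (2 * N) / (3 * real M)"
    using M1 by simp
  ultimately have A0: "A > 0"
    by linarith
  \<comment> \<open>The mean 2h = 3\<delta>/2 exceeds \<delta>, and a margin \<delta>/4 remains
    between the window and the points at distance \<delta>.\<close>
  define h where "h = 3 * \<delta> / 4"
  define J where "J y = fejer M y ^ N / A" for y
  have J0: "J y \<ge> 0" for y
    using A0 by (simp add: J_def)
  have J_tp: "trig_poly (N * (M - 1)) (\<lambda>y. of_real (J y))"
    using trig_poly_cmult [OF trig_poly_power [OF trig_poly_fejer, of N M], of "inverse (of_real A)"]
    by (simp add: J_def divide_inverse mult.commute)
  have J_mean: "integral {0..1} J = 1"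
    using A0 unfolding J_def by (simp add: A_def)
  define f where "f y = integral {- h..h} (\<lambda>z. J (y - z))" for y
  have cont: "continuous_on UNIV J"
    using J_tp by (rule trig_poly_continuous_on_real)
  have io: "(\<lambda>z. J (y - z)) integrable_on {a..b}" for y a b
    by (intro integrable_continuous_real continuous_on_compose2 [OF cont] continuous_intros) auto
  have h: "h \<ge> 0" "h \<le> 1 / 2"
    using \<delta> by (auto simp: h_def)
  show thesis
  proof
    show "trig_poly (N * (M - 1)) (\<lambda>y. of_real (f y))"
      unfolding f_def using trig_poly_average(1) [OF J_tp h(1)] .
    have "real (N * (M - 1)) \<le> real N * real M"
      unfolding of_nat_mult by (intro mult_left_mono) auto
    also have "\<dots> \<le> K / \<delta>"
      using M_le N \<delta> by (simp add: field_simps)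
    finally show "real (N * (M - 1)) \<le> K / \<delta>" .
    show "f y \<ge> 0" for y
      unfolding f_def by (intro integral_nonneg io J0)
    show "f y \<le> 1" for y
    proof -
      \<comment> \<open>The window is enlarged to a full period, over which J has integral
        1.\<close>
      have "f y \<le> integral {- 1 / 2..1 / 2} (\<lambda>z. J (y - z))"
        unfolding f_def using h J0 by (intro integral_subset_le io) auto
      also have "\<dots> = 1"
      proof -
        have "(J has_integral 1) {y - 1 / 2..y + 1 / 2}"
          using trig_poly_has_integral_unit [OF J_tp, of "y - 1 / 2"] J_mean by (simp add: algebra_simps)
        then have "((\<lambda>z. J (y + z)) has_integral 1) {- (1 / 2)..1 / 2}"
          using has_integral_affinity' [of J 1 "y - 1 / 2" "y + 1 / 2" 1 y] by (simp add: add.commute)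
        then have "((\<lambda>z. J (y + - z)) has_integral 1) {- (1 / 2)..- (- (1 / 2))}"
          by (rule has_integral_reflect_real [THEN iffD2])
        then show ?thesis
          by (simp add: integral_unique)
      qed
      finally show ?thesis .
    qed
    show "f y \<le> 36 * (16 * real N / K) ^ N" if y: "\<forall>r::int. \<bar>y - of_int r\<bar> \<ge> \<delta>" for y
    proof -
      \<comment> \<open>The tail bound (4/\<delta>)^(2N) from \<open>fejer_upper\<close>, divided by
        the lower bound for \<open>A\<close>.\<close>
      let ?B = "3 * real M * (8 / (real M * \<delta>)) ^ (2 * N)"
      have J_le: "J (y - z) \<le> ?B" if z: "z \<in> {- h..h}" for z
      proof -
        have "\<delta> / 4 \<le> \<bar>y - z - of_int r\<bar>" for r
          using y [rule_format, of r] z by (auto simp: h_def abs_if split: if_splits)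
        then have "fejer M (y - z) \<le> (1 / (\<delta> / 4))\<^sup>2"
          using \<delta> by (intro fejer_upper) auto
        then have "fejer M (y - z) ^ N \<le> (4 / \<delta>) ^ (2 * N)"
          unfolding power_mult by (intro power_mono) auto
        then have "J (y - z) \<le> (4 / \<delta>) ^ (2 * N) / ((real M / 2) ^ (2 * N) / (3 * real M))"
          unfolding J_def using A M1 \<delta> by (intro frac_le) auto
        also have "\<dots> = 3 * real M * ((4 / \<delta>) / (real M / 2)) ^ (2 * N)"
          unfolding power_divide [of "4 / \<delta>"] by simp
        finally show ?thesis
          by (simp add: mult.commute)
      qed
      have "f y \<le> integral {- h..h} (\<lambda>z. ?B)"
        unfolding f_def by (intro integral_le io J_le) auto
      \<comment> \<open>The window length 3\<delta>/2 times 3M is (9/2) M \<delta>. One factor 8/(M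
        \<delta>) is split off the power, possible as N \<ge> 1, and cancels M \<delta>, leaving
        36.\<close>
      also have "\<dots> = 9 / 2 * (real M * \<delta>) * (8 / (real M * \<delta>)) ^ Suc (2 * N - 1)"
        using h N by (simp add: h_def)
      also have "\<dots> = 36 * (8 / (real M * \<delta>)) ^ (2 * N - 1)"
        using M1 \<delta> by (subst power_Suc) (simp add: field_simps)
      also have "\<dots> \<le> 36 * (16 * real N / K) ^ (2 * N - 1)"
      proof -
        have "8 / (real M * \<delta>) \<le> 16 * real N / K"
          using M_ge M1 \<delta> K0 N by (simp add: field_simps)
        then show ?thesis
          using \<delta> by (intro mult_left_mono power_mono) auto
      qed
      \<comment> \<open>The base is at most 1 since K \<ge> 16 N, and 2N - 1 \<ge> N.\<close>
      also have "\<dots> \<le> 36 * (16 * real N / K) ^ N"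
        using K K0 N by (intro mult_left_mono power_decreasing) auto
      finally show ?thesis .
    qed
    have "integral {0..1} f = 2 * h"
      unfolding f_def using trig_poly_average(2) [OF J_tp h(1)] J_mean by simp
    then show "\<delta> \<le> integral {0..1} f"
      using \<delta> by (simp add: h_def)
  qed
qed

section \<open>Averaging trigonometric polynomials over \<open>\<mu>\<close>\<close>

definition linear_form :: "nat \<Rightarrow> (nat \<Rightarrow> int) \<Rightarrow> (nat \<Rightarrow> real) \<Rightarrow> real" where
  "linear_form d q x = (\<Sum>j<d. of_int (q j) * x j)"

lemma linear_form_measurable [measurable]:
  "i < n \<Longrightarrow> (\<lambda>x. linear_form d q (x i)) \<in> borel_measurable (borel_blocks n d)"
  unfolding linear_form_def borel_blocks_def
  by (intro borel_measurable_sum borel_measurable_times borel_measurable_const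
      measurable_compose [OF measurable_component_singleton [of i]]
      measurable_component_singleton) auto

lemma prod_cis: "(\<Prod>i\<in>I. cis (f i)) = cis (\<Sum>i\<in>I. f i)"
  by (induction I rule: infinite_finite_induct) (auto simp: cis_mult)

text \<open>At the frequency (t_1 q, ..., t_n q) the phase is the sum of t_i (q . x_i), so the
  exponential factors over the blocks.\<close>

lemma fourier_transform_eq_character:
  "fourier_transform n d \<mu> (\<lambda>i j. of_int (t i * q j))
     = (\<integral>x. (\<Prod>i<n. character (t i) (linear_form d q (x i))) \<partial>\<mu>)"
proof -
  have "exp (- 2 * of_real pi * \<i> * of_real (\<Sum>i<n. \<Sum>j<d. x i j * of_int (t i * q j)))
      = (\<Prod>i<n. character (t i) (linear_form d q (x i)))" for x :: "nat \<Rightarrow> nat \<Rightarrow> real"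
  proof -
    have "(\<Sum>i<n. - (2 * pi * (of_int (t i) * linear_form d q (x i))))
        = - (2 * pi * (\<Sum>i<n. \<Sum>j<d. x i j * of_int (t i * q j)))"
      by (simp add: linear_form_def sum_distrib_left sum_negf mult_ac)
    then show ?thesis
      unfolding character_def prod_cis by (simp add: cis_conv_exp algebra_simps)
  qed
  then show ?thesis
    unfolding fourier_transform_def by simp
qed

lemma fourier_sum_nonneg: "fourier_sum n d q \<mu> R \<ge> 0"
  unfolding fourier_sum_def by (intro sum_nonneg) auto

text \<open>Accounts for all terms of the expanded product except the main one. The zero tuple is
  written as a restricted function because the box consists of extensional functions.\<close>

lemma nonzero_box_subset_frequencies:
  assumes n: "n \<ge> 1" and D: "real D \<le> R"
  shows "({..<n} \<rightarrow>\<^sub>E {- int D..int D}) - {\<lambda>i\<in>{..<n}. 0} \<subseteq> frequencies n R"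
proof
  fix t assume t: "t \<in> ({..<n} \<rightarrow>\<^sub>E {- int D..int D}) - {\<lambda>i\<in>{..<n}. 0}"
  have "\<exists>i<n. t i \<noteq> 0"
  proof (rule ccontr)
    assume "\<not> ?thesis"
    then have "t = (\<lambda>i\<in>{..<n}. 0)"
      using t by (intro ext) (auto simp: PiE_iff extensional_def)
    then show False
      using t by simp
  qed
  then obtain i where i: "i < n" "t i \<noteq> 0"
    by blast
  then have "0 < \<bar>t i\<bar>"
    by simp
  also have "\<dots> \<le> max_norm n t"
    unfolding max_norm_def using i by (intro Max_ge) auto
  finally have "0 < max_norm n t" .
  moreover have "max_norm n t \<le> int D"
    unfolding max_norm_def using t n by (subst Max_le_iff) (force simp: PiE_iff abs_le_iff)+
  then have "real_of_int (max_norm n t) \<le> R"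
    using D by linarith
  ultimately show "t \<in> frequencies n R"
    using t by (auto simp: frequencies_def PiE_iff)
qed

text \<open>The product expands into a sum over tuples t in a box. The zero tuple contributes a^n,
  as \<mu> has mass 1; any other contributes at most a^n times the modulus of the transform, because
  each of its n coefficients is bounded by a.\<close>

lemma expectation_trig_poly_product:
  assumes \<mu>: "prob_on_cube n d \<mu>" and n: "n \<ge> 1"
    and f: "trig_poly D (\<lambda>y. of_real (f y))" "\<And>y. f y \<ge> 0" and D: "real D \<le> R"
  defines "a \<equiv> integral {0..1} f"
  shows "integrable \<mu> (\<lambda>x. \<Prod>i<n. f (linear_form d q (x i)))"
    and "\<bar>(\<integral>x. (\<Prod>i<n. f (linear_form d q (x i))) \<partial>\<mu>) - a ^ n\<bar> \<le> a ^ n * fourier_sum n d q \<mu> R"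
proof -
  interpret prob_space \<mu>
    using \<mu> by (simp add: prob_on_cube_def)
  have sets: "sets \<mu> = sets (borel_blocks n d)"
    using \<mu> by (simp add: prob_on_cube_def)
  obtain c where c: "\<And>y. complex_of_real (f y) = (\<Sum>k\<in>{- int D..int D}. c k * character k y)"
    and c0: "c 0 = of_real a" and c_le: "\<And>k. k \<in> {- int D..int D} \<Longrightarrow> cmod (c k) \<le> a"
    using nonneg_trig_poly_coeffs [OF f] unfolding a_def by blast
  have a0: "a \<ge> 0"
    using order_trans [OF norm_ge_zero c_le [of 0]] by simp
  define T where "T = {..<n} \<rightarrow>\<^sub>E {- int D..int D}"
  define z :: "nat \<Rightarrow> int" where "z = (\<lambda>i\<in>{..<n}. 0)"
  define p where "p x = (\<Prod>i<n. f (linear_form d q (x i)))" for x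
  define e where "e t x = (\<Prod>i<n. character (t i) (linear_form d q (x i)))" for t x
  have T: "finite T" "z \<in> T"
    unfolding T_def z_def by (auto intro!: finite_PiE)
  have p: "complex_of_real (p x) = (\<Sum>t\<in>T. (\<Prod>i<n. c (t i)) * e t x)" for x
  proof -
    have "complex_of_real (p x)
        = (\<Prod>i<n. \<Sum>k\<in>{- int D..int D}. c k * character k (linear_form d q (x i)))"
      by (simp add: p_def c)
    then show ?thesis
      by (subst (asm) prod_sum_PiE) (auto simp: T_def e_def prod.distrib)
  qed
  have e_meas: "e t \<in> borel_measurable \<mu>" for t
  proof -
    have "(\<lambda>x. character (t i) (linear_form d q (x i))) \<in> borel_measurable (borel_blocks n d)"
      if "i < n" for i
      using that borel_measurable_continuous_onI [OF continuous_on_character] by measurable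
    then have "e t \<in> borel_measurable (borel_blocks n d)"
      unfolding e_def by (intro borel_measurable_prod) auto
    then show ?thesis
      by (simp add: measurable_cong_sets [OF sets refl])
  qed
  have e_int: "integrable \<mu> (e t)" for t
    using e_meas by (intro integrable_const_bound [of _ 1]) (auto simp: e_def prod_norm [symmetric])
  have p_int: "integrable \<mu> (\<lambda>x. complex_of_real (p x))"
    unfolding p using e_int by auto
  show "integrable \<mu> (\<lambda>x. \<Prod>i<n. f (linear_form d q (x i)))"
    using integrable_Re [OF p_int] unfolding p_def Re_complex_of_real .
  define F where "F t = fourier_transform n d \<mu> (\<lambda>i j. of_int (t i * q j))" for t
  have F: "F t = (\<integral>x. e t x \<partial>\<mu>)" for t
    unfolding F_def e_def by (rule fourier_transform_eq_character)
  have "complex_of_real (\<integral>x. p x \<partial>\<mu>) = (\<integral>x. complex_of_real (p x) \<partial>\<mu>)"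
    by simp
  also have "\<dots> = (\<Sum>t\<in>T. (\<Prod>i<n. c (t i)) * F t)"
    unfolding p F using e_int by (subst Bochner_Integration.integral_sum) auto
  \<comment> \<open>The zero frequency is isolated as the main term.\<close>
  also have "\<dots> = (\<Prod>i<n. c (z i)) * F z + (\<Sum>t\<in>T - {z}. (\<Prod>i<n. c (t i)) * F t)"
    using T by (rule sum.remove)
  also have "(\<Prod>i<n. c (z i)) * F z = of_real (a ^ n)"
    unfolding F e_def by (simp add: z_def c0 prob_space)
  finally have "complex_of_real ((\<integral>x. p x \<partial>\<mu>) - a ^ n) = (\<Sum>t\<in>T - {z}. (\<Prod>i<n. c (t i)) * F t)"
    by simp
  then have "\<bar>(\<integral>x. p x \<partial>\<mu>) - a ^ n\<bar> = cmod (\<Sum>t\<in>T - {z}. (\<Prod>i<n. c (t i)) * F t)"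
    by (metis norm_of_real real_norm_def)
  also have "\<dots> \<le> (\<Sum>t\<in>T - {z}. cmod ((\<Prod>i<n. c (t i)) * F t))"
    by (rule norm_sum)
  also have "\<dots> \<le> (\<Sum>t\<in>T - {z}. a ^ n * cmod (F t))"
  proof (intro sum_mono)
    fix t assume t: "t \<in> T - {z}"
    have "(\<Prod>i<n. cmod (c (t i))) \<le> (\<Prod>i<n. a)"
      using t by (intro prod_mono) (auto simp: T_def PiE_iff intro!: c_le)
    then show "cmod ((\<Prod>i<n. c (t i)) * F t) \<le> a ^ n * cmod (F t)"
      unfolding norm_mult prod_norm [symmetric] by (intro mult_right_mono) auto
  qed
  also have "\<dots> \<le> (\<Sum>t\<in>frequencies n R. a ^ n * cmod (F t))"
    using nonzero_box_subset_frequencies [OF n D] a0 unfolding T_def z_def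
    by (intro sum_mono2 finite_frequencies) auto
  also have "\<dots> = a ^ n * fourier_sum n d q \<mu> R"
    by (simp add: fourier_sum_def F_def sum_distrib_left)
  finally show "\<bar>(\<integral>x. (\<Prod>i<n. f (linear_form d q (x i))) \<partial>\<mu>) - a ^ n\<bar> \<le> a ^ n * fourier_sum n d q \<mu> R"
    unfolding p_def .
qed

section \<open>The upper and lower bounds for the measure\<close>

lemma mem_L_power_iff:
  assumes "x \<in> space (borel_blocks n d)"
  shows "x \<in> L_power n d \<delta> q \<longleftrightarrow> (\<forall>i<n. \<exists>r::int. \<bar>linear_form d q (x i) - of_int r\<bar> < \<delta>)"
  using assms
  by (auto simp: L_power_def L_def linear_form_def borel_blocks_def space_PiM PiE_iff)

text \<open>The product of the majorants dominates the indicator of the set, and its main term is at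
  most (24 \<delta>)^n.\<close>

lemma measure_L_power_le:
  assumes \<mu>: "prob_on_cube n d \<mu>" and n: "n \<ge> 1" and \<delta>: "\<delta> > 0"
  shows "measure \<mu> (L_power n d \<delta> q) \<le> 24 ^ n * \<delta> ^ n * (1 + fourier_sum n d q \<mu> (2 / \<delta>))"
proof -
  interpret prob_space \<mu>
    using \<mu> by (simp add: prob_on_cube_def)
  have sets: "sets \<mu> = sets (borel_blocks n d)"
    using \<mu> by (simp add: prob_on_cube_def)
  have Lm: "L_power n d \<delta> q \<in> sets \<mu>"
    unfolding sets by (rule L_power_measurable)
  obtain f D where f: "trig_poly D (\<lambda>y. of_real (f y))" and D: "real D \<le> 2 / \<delta>"
    and f0: "\<And>y. f y \<ge> 0" and f1: "\<And>y r. \<bar>y - of_int r\<bar> < \<delta> \<Longrightarrow> 1 \<le> f y"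
    and mean: "integral {0..1} f \<le> 24 * \<delta>"
    by (rule trig_poly_majorant [OF \<delta>]) (rule that)
  note E = expectation_trig_poly_product [OF \<mu> n f f0 D, of q]
  let ?F = "fourier_sum n d q \<mu> (2 / \<delta>)"
  have mean0: "integral {0..1} f \<ge> 0"
    using trig_poly_has_integral_unit [OF f, of 0] f0
    by (intro integral_nonneg) (auto simp: has_integral_integrable)
  have "measure \<mu> (L_power n d \<delta> q) = (\<integral>x. indicator (L_power n d \<delta> q) x \<partial>\<mu>)"
    using Lm by simp
  also have "\<dots> \<le> (\<integral>x. (\<Prod>i<n. f (linear_form d q (x i))) \<partial>\<mu>)"
  proof (rule integral_mono [OF _ E(1)])
    show "integrable \<mu> (indicat_real (L_power n d \<delta> q))"
      using Lm by (intro integrable_real_indicator) (auto simp: less_top [symmetric])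
    fix x assume "x \<in> space \<mu>"
    then have x: "x \<in> space (borel_blocks n d)"
      using sets_eq_imp_space_eq [OF sets] by simp
    show "indicat_real (L_power n d \<delta> q) x \<le> (\<Prod>i<n. f (linear_form d q (x i)))"
    proof (cases "x \<in> L_power n d \<delta> q")
      case True
      then have "1 \<le> (\<Prod>i<n. f (linear_form d q (x i)))"
        using mem_L_power_iff [OF x] f1 by (intro prod_ge_1) blast
      then show ?thesis
        using True by simp
    qed (simp add: prod_nonneg f0)
  qed
  also have "\<dots> \<le> integral {0..1} f ^ n * (1 + ?F)"
    using E(2) by (simp add: algebra_simps)
  also have "\<dots> \<le> (24 * \<delta>) ^ n * (1 + ?F)"
    using mean mean0 fourier_sum_nonneg [of n d q \<mu> "2 / \<delta>"]
    by (intro mult_right_mono power_mono) auto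
  finally show ?thesis
    by (simp add: power_mult_distrib)
qed

text \<open>The minorant requires \<delta> \<le> 1/2, N \<ge> 1 and K \<ge> 16 N. Outside this range
  the set is everything or the error term is at least 1, which settles the bound because \<delta>^n
  \<le> 1.\<close>

lemma measure_L_power_ge:
  assumes \<mu>: "prob_on_cube n d \<mu>" and n: "n \<ge> 1" and \<delta>: "0 < \<delta>" "\<delta> \<le> 1" and K: "K > 0"
  shows "\<delta> ^ n * (1 - fourier_sum n d q \<mu> (K / \<delta>)) - (36 * (16 * real N) ^ N + 1) / K ^ N
    \<le> measure \<mu> (L_power n d \<delta> q)"
proof -
  interpret prob_space \<mu>
    using \<mu> by (simp add: prob_on_cube_def)
  have sets: "sets \<mu> = sets (borel_blocks n d)"
    using \<mu> by (simp add: prob_on_cube_def)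
  have Lm: "L_power n d \<delta> q \<in> sets \<mu>"
    unfolding sets by (rule L_power_measurable)
  let ?F = "fourier_sum n d q \<mu> (K / \<delta>)" and ?L = "L_power n d \<delta> q"
  let ?C = "36 * (16 * real N) ^ N + 1"
  have F0: "?F \<ge> 0"
    by (rule fourier_sum_nonneg)
  have \<delta>n: "\<delta> ^ n \<le> 1" "\<delta> ^ n \<ge> 0"
    using \<delta> by (auto intro: power_le_one)
  have C0: "?C / K ^ N \<ge> 0"
    using K by (intro divide_nonneg_nonneg add_nonneg_nonneg) auto
  have prod_le: "\<delta> ^ n * (1 - ?F) \<le> \<delta> ^ n * 1"
    using \<delta>n F0 by (intro mult_left_mono) auto
  \<comment> \<open>If \<open>?F > 1\<close> the main term is negative; splitting this off leaves 1
    - \<open>?F\<close> nonnegative in the last case, where \<delta> is replaced by the larger mean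
    of f.\<close>
  consider "?F > 1" | "\<delta> > 1 / 2" | "N = 0 \<or> K < 16 * real N" | "?F \<le> 1" "\<delta> \<le> 1 / 2" "N \<ge> 1" "K \<ge> 16 * real N"
    by linarith
  then show ?thesis
  proof cases
    case 1
    then have "\<delta> ^ n * (1 - ?F) \<le> 0"
      using \<delta>n by (intro mult_nonneg_nonpos) auto
    then show ?thesis
      using C0 measure_nonneg [of \<mu> ?L] by linarith
  next
    case 2
    \<comment> \<open>Every real number is within 1/2 < \<delta> of its nearest integer.\<close>
    have "x \<in> ?L" if "x \<in> space (borel_blocks n d)" for x
      unfolding mem_L_power_iff [OF that]
    proof (intro allI impI exI)
      fix i
      show "\<bar>linear_form d q (x i) - of_int (round (linear_form d q (x i)))\<bar> < \<delta>"
        using of_int_round_abs_le [of "linear_form d q (x i)"] 2 by (simp add: abs_minus_commute)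
    qed
    then have "?L = space \<mu>"
      using sets.sets_into_space [OF Lm] sets_eq_imp_space_eq [OF sets] by auto
    then have "measure \<mu> ?L = 1"
      using prob_space by simp
    then show ?thesis
      using prod_le \<delta>n C0 by linarith
  next
    case 3
    have "K ^ N \<le> ?C"
    proof (cases "N = 0")
      case False
      then have "K ^ N \<le> (16 * real N) ^ N"
        using 3 K by (intro power_mono) auto
      moreover have "(16 * real N) ^ N \<ge> 0"
        by simp
      ultimately show ?thesis
        by linarith
    qed simp
    then have "1 \<le> ?C / K ^ N"
      using K by simp
    then show ?thesis
      using prod_le \<delta>n measure_nonneg [of \<mu> ?L] by linarith
  next
    case 4
    obtain f D where f: "trig_poly D (\<lambda>y. of_real (f y))" and D: "real D \<le> K / \<delta>"
      and f0: "\<And>y. f y \<ge> 0" and f1: "\<And>y. f y \<le> 1"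
      and f_off: "\<And>y. \<forall>r::int. \<bar>y - of_int r\<bar> \<ge> \<delta> \<Longrightarrow> f y \<le> 36 * (16 * real N / K) ^ N"
      and mean: "integral {0..1} f \<ge> \<delta>"
      by (rule trig_poly_minorant [OF \<delta>(1) 4(2-4)]) (rule that)
    note E = expectation_trig_poly_product [OF \<mu> n f f0 D, of q]
    let ?\<epsilon> = "36 * (16 * real N / K) ^ N"
    have ind_int: "integrable \<mu> (indicat_real ?L)"
      using Lm by (intro integrable_real_indicator) (auto simp: less_top [symmetric])
    have "\<delta> ^ n * (1 - ?F) \<le> integral {0..1} f ^ n * (1 - ?F)"
      using mean \<delta> 4 by (intro mult_right_mono power_mono) auto
    also have "\<dots> \<le> (\<integral>x. (\<Prod>i<n. f (linear_form d q (x i))) \<partial>\<mu>)"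
      using E(2) by (simp add: algebra_simps)
    also have "\<dots> \<le> (\<integral>x. indicator ?L x + ?\<epsilon> \<partial>\<mu>)"
    proof (rule integral_mono [OF E(1)])
      show "integrable \<mu> (\<lambda>x. indicat_real ?L x + ?\<epsilon>)"
        using ind_int by simp
      fix x assume "x \<in> space \<mu>"
      then have x: "x \<in> space (borel_blocks n d)"
        using sets_eq_imp_space_eq [OF sets] by simp
      show "(\<Prod>i<n. f (linear_form d q (x i))) \<le> indicat_real ?L x + ?\<epsilon>"
      proof (cases "x \<in> ?L")
        case True
        have "(\<Prod>i<n. f (linear_form d q (x i))) \<le> 1"
          using f0 f1 by (intro prod_le_1) auto
        moreover have "?\<epsilon> \<ge> 0"
          using K by simp
        ultimately show ?thesis
          using True by simp
      next
        case False
        then obtain i where i: "i < n" "\<forall>r::int. \<bar>linear_form d q (x i) - of_int r\<bar> \<ge> \<delta>"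
          using mem_L_power_iff [OF x] by (metis not_le)
        \<comment> \<open>One bad block already makes the product small, since the other factors are
          at most 1; thus the error does not grow with n.\<close>
        have "(\<Prod>i<n. f (linear_form d q (x i)))
            = f (linear_form d q (x i)) * (\<Prod>j\<in>{..<n} - {i}. f (linear_form d q (x j)))"
          using i by (intro prod.remove) auto
        also have "\<dots> \<le> ?\<epsilon> * 1"
          using f_off [OF i(2)] f0 f1 K by (intro mult_mono prod_le_1 prod_nonneg) auto
        finally show ?thesis
          using False by simp
      qed
    qed
    also have "\<dots> = measure \<mu> ?L + ?\<epsilon>"
      using Lm ind_int by (subst Bochner_Integration.integral_add) (auto simp: prob_space)
    also have "?\<epsilon> \<le> ?C / K ^ N"
      using K by (simp add: power_divide field_simps)
    finally show ?thesis
      by simp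
  qed
qed

text \<open>The power \<open>C\<^sub>1 ^ n\<close> reflects Lebesgue measure: for \<delta> < 1/2 all
  the transforms in the sum vanish and the measure is (2\<delta>)^n. In the lower bound \<delta>
  \<le> 1 keeps \<delta>^n from exceeding the total mass: for \<delta> = 4, K = 2 and N = 0 the sum
  is empty, while 4^n is unbounded. The two measure bounds supply \<open>C\<^sub>1\<close> = 24 and
  the value 1 for \<open>C\<^sub>2\<close>, \<open>c\<^sub>1\<close> and
  \<open>c\<^sub>2\<close>.\<close>

theorem theorem5:
  shows "\<exists>(C\<^sub>1::real) (C\<^sub>2::real) (c\<^sub>1::real) (c\<^sub>2::real) (C :: nat \<Rightarrow> real).
    C\<^sub>1 > 0 \<and> C\<^sub>2 > 0 \<and> c\<^sub>1 > 0 \<and> c\<^sub>2 > 0 \<and> (\<forall>N. C N > 0) \<and>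
    (\<forall>(d::nat) (n::nat) (q :: nat \<Rightarrow> int) (\<delta>::real) (\<mu> :: (nat \<Rightarrow> nat \<Rightarrow> real) measure).
       d \<ge> 1 \<longrightarrow> n \<ge> 1 \<longrightarrow> (\<exists>j<d. q j \<noteq> 0) \<longrightarrow> \<delta> > 0 \<longrightarrow> prob_on_cube n d \<mu> \<longrightarrow>
         measure \<mu> (L_power n d \<delta> q)
           \<le> C\<^sub>1 ^ n * \<delta> ^ n * (1 + C\<^sub>2 * fourier_sum n d q \<mu> (2 / \<delta>)) \<and>
         (\<delta> \<le> 1 \<longrightarrow> (\<forall>(K::real) (N::nat). K > 0 \<longrightarrow>
            measure \<mu> (L_power n d \<delta> q)
              \<ge> c\<^sub>1 * \<delta> ^ n * (1 - c\<^sub>2 * fourier_sum n d q \<mu> (K / \<delta>)) - C N * K powi (- int N))))"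
proof (rule exI [of _ 24], rule exI [of _ 1], rule exI [of _ 1], rule exI [of _ 1],
    rule exI [of _ "\<lambda>N. 36 * (16 * real N) ^ N + 1"], intro conjI allI impI)
  show "0 < 36 * (16 * real N) ^ N + 1" for N
    by (intro add_nonneg_pos) auto
next
  fix d n :: nat and q :: "nat \<Rightarrow> int" and \<delta> :: real and \<mu> :: "(nat \<Rightarrow> nat \<Rightarrow> real) measure"
  assume "n \<ge> 1" "\<delta> > 0" "prob_on_cube n d \<mu>"
  then show "measure \<mu> (L_power n d \<delta> q) \<le> 24 ^ n * \<delta> ^ n * (1 + 1 * fourier_sum n d q \<mu> (2 / \<delta>))"
    using measure_L_power_le by simp
next
  fix d n N :: nat and q :: "nat \<Rightarrow> int" and \<delta> K :: real and \<mu> :: "(nat \<Rightarrow> nat \<Rightarrow> real) measure"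
  assume "n \<ge> 1" "\<delta> > 0" "prob_on_cube n d \<mu>" "\<delta> \<le> 1" "K > 0"
  then show "1 * \<delta> ^ n * (1 - 1 * fourier_sum n d q \<mu> (K / \<delta>))
      - (36 * (16 * real N) ^ N + 1) * K powi (- int N) \<le> measure \<mu> (L_power n d \<delta> q)"
    using measure_L_power_ge [of n d \<mu> \<delta> K q N] by (simp add: power_int_minus divide_inverse)
qed auto

end
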